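(* Let $\mathcal X,\mathcal Y$ be finite-dimensional Euclidean spaces, let $A:\mathcal X\to\mathcal Y$ be a linear map with adjoint $A^*$, and let $\mathcal C\subseteq\mathcal Y$ be a nonempty closed convex set with $0\notin\mathcal C$. Suppose that $A^{-1}\mathcal C\neq\emptyset$, and either $\mathcal C$ is polyhedral or $\operatorname{ri}\mathcal C\cap\operatorname{range}A\neq\emptyset$. Then $(A^{-1}\mathcal C)'$ is nonempty and $$(A^{-1}\mathcal C)'=A^*\mathcal C'.$$
   Context: The antipolar of a set $\mathcal D$ is $\mathcal D'=\{y\mid\langle y,x\rangle\ge1\ \forall x\in\mathcal D\}$. $A^{-1}\mathcal C$ is the preimage of $\mathcal C$ under $A$, and $A^*\mathcal C'$ is the image of $\mathcal C'$ under $A^*$. $\operatorname{ri}$ denotes relative interior. *)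

theory Defs
  imports "HOL-Analysis.Analysis"
begin

definition antipolar :: "'a::real_inner set \<Rightarrow> 'a set" where
  "antipolar D = {y. \<forall>x\<in>D. y \<bullet> x \<ge> 1}"

end

theory Submission
  imports Defs
begin

text \<open>
  Adjointness gives one inclusion, and \<open>0\<close> is strictly separated from the closed convex set
  \<open>A\<^sup>-\<^sup>1 C\<close>. Conversely, let \<open>z \<bullet> x \<ge> 1\<close> on \<open>A\<^sup>-\<^sup>1 C\<close>. If \<open>C\<close> is polyhedral, the pairs
  \<open>(A\<^sup>* v, s)\<close> with \<open>(v, s)\<close> in the cone generated by the inequalities \<open>v \<bullet> c \<le> s\<close> defining \<open>C\<close>
  form a finitely generated, hence closed, cone, and separation from it shows that it contains
  \<open>(-z, -1)\<close>. In the other case, properly separate \<open>C\<close> from the image under \<open>A\<close> of the half-space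
  \<open>z \<bullet> x < 1\<close>: if \<open>a\<close> is the separating normal, then \<open>A\<^sup>* a\<close> is a multiple of \<open>z\<close>, and a zero
  multiple is excluded because \<open>a\<close> would vanish at a relative interior point of \<open>C\<close>, hence on \<open>C\<close>.
\<close>

section \<open>The inclusion by adjointness, and nonemptiness\<close>

lemma adjoint_antipolar_subset:
  fixes A :: "'x::euclidean_space \<Rightarrow> 'y::euclidean_space"
  assumes "linear A"
  shows "adjoint A ` antipolar C \<subseteq> antipolar (A -` C)"
  using assms by (auto simp: antipolar_def adjoint_clauses)

lemma antipolar_nonempty:
  fixes D :: "'a::euclidean_space set"
  assumes "convex D" "closed D" "0 \<notin> D"
  shows "antipolar D \<noteq> {}"
proof -
  obtain a b where b: "0 < b" and a: "\<And>x. x \<in> D \<Longrightarrow> b < a \<bullet> x"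
    using separating_hyperplane_closed_0[OF assms] by blast
  have "(1 / b) *\<^sub>R a \<in> antipolar D"
    using a b by (force simp: antipolar_def field_simps)
  then show ?thesis by blast
qed

section \<open>Linear functionals bounded on rays and half-spaces\<close>

lemma bounded_above_on_ray_imp_nonpos:
  fixes m b q :: real
  assumes "\<And>t. t > 0 \<Longrightarrow> b + t * m \<le> q"
  shows "m \<le> 0"
proof (rule ccontr)
  assume m: "\<not> m \<le> 0"
  have "b + ((\<bar>q - b\<bar> + 1) / m) * m \<le> q"
    using m by (intro assms) (auto intro!: divide_pos_pos)
  then show False using m by simp
qed

text \<open>The half-space contains the whole line spanned by the component \<open>r\<close> of
  \<open>p\<close> orthogonal to \<open>z\<close>, so boundedness kills \<open>r\<close>. Along
  \<open>z\<close> the bound reads \<open>l * s \<le> q\<close> for all \<open>s < 1\<close>: large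
  negative \<open>s\<close> gives \<open>0 \<le> l\<close>, and letting \<open>s\<close> tend to
  \<open>1\<close> gives \<open>l \<le> q\<close>.\<close>

lemma halfspace_functional_bounded:
  fixes z p :: "'a::real_inner"
  assumes bd: "\<And>x. z \<bullet> x < 1 \<Longrightarrow> p \<bullet> x \<le> q" and z: "z \<noteq> 0"
  obtains l where "0 \<le> l" "l \<le> q" "p = l *\<^sub>R z"
proof -
  define l where "l = (p \<bullet> z) / (z \<bullet> z)"
  define r where "r = p - l *\<^sub>R z"
  have zz: "z \<bullet> z > 0" using z by simp
  have rz: "r \<bullet> z = 0"
    using z by (simp add: r_def l_def inner_diff_left)
  then have zr: "z \<bullet> r = 0" by (simp add: inner_commute)
  have pr: "p \<bullet> r = r \<bullet> r"
    using zr by (simp add: r_def inner_diff_left)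
  have "r \<bullet> r \<le> 0"
  proof (rule bounded_above_on_ray_imp_nonpos)
    fix t :: real
    show "0 + t * (r \<bullet> r) \<le> q"
      using bd[of "t *\<^sub>R r"] by (simp add: zr pr)
  qed
  then have "r = 0" using inner_ge_zero[of r] inner_eq_zero_iff[of r] by linarith
  then have p: "p = l *\<^sub>R z" by (simp add: r_def)
  have bound: "l * s \<le> q" if "s < 1" for s
    using bd[of "(s / (z \<bullet> z)) *\<^sub>R z"] that z by (simp add: p mult.commute)
  have "- l \<le> 0"
  proof (rule bounded_above_on_ray_imp_nonpos)
    fix t :: real
    assume "t > 0"
    then show "0 + t * (- l) \<le> q" using bound[of "- t"] by (simp add: mult.commute[of t])
  qed
  moreover have "l \<le> q"
  proof (rule tendsto_upperbound)
    show "((\<lambda>s. l * s) \<longlongrightarrow> l) (at_left 1)" by (auto intro!: tendsto_eq_intros)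
    show "\<forall>\<^sub>F s in at_left 1. l * s \<le> q"
      using bound by (auto simp: eventually_at_filter)
  qed simp
  ultimately show thesis using p that by simp
qed

section \<open>The relative interior case\<close>

lemma rel_interior_minimum_imp_constant:
  fixes C :: "'a::euclidean_space set"
  assumes "convex C" and c0: "c0 \<in> rel_interior C"
    and min: "\<And>c. c \<in> C \<Longrightarrow> a \<bullet> c0 \<le> a \<bullet> c" and c: "c \<in> C"
  shows "a \<bullet> c = a \<bullet> c0"
proof -
  \<comment> \<open>The segment from \<open>c\<close> to \<open>c0\<close> extends beyond
    \<open>c0\<close> inside \<open>C\<close>. If \<open>a\<close> were larger at \<open>c\<close>
    than at \<open>c0\<close>, it would drop below its minimum there.\<close>
  obtain e where e: "e > 1" "(1 - e) *\<^sub>R c + e *\<^sub>R c0 \<in> C"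
    using convex_rel_interior_iff[OF \<open>convex C\<close>, of c0] c c0 by blast
  have "(e - 1) * (a \<bullet> c - a \<bullet> c0) \<le> 0"
    using min[OF e(2)] by (simp add: inner_add_right algebra_simps)
  then have "a \<bullet> c \<le> a \<bullet> c0"
    using e(1) by (simp add: mult_le_0_iff)
  then show ?thesis using min[OF c] by simp
qed

lemma antipolar_vimage_subset_rel_interior:
  fixes A :: "'x::euclidean_space \<Rightarrow> 'y::euclidean_space"
  assumes lin: "linear A" and conv: "convex C"
    and ri: "rel_interior C \<inter> range A \<noteq> {}"
  shows "antipolar (A -` C) \<subseteq> adjoint A ` antipolar C"
proof
  fix z assume "z \<in> antipolar (A -` C)"
  then have z: "z \<bullet> x \<ge> 1" if "A x \<in> C" for x
    using that by (auto simp: antipolar_def)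
  obtain x0 where x0: "A x0 \<in> rel_interior C" using ri by blast
  then have x0C: "A x0 \<in> C" using rel_interior_subset by blast
  have z0: "z \<noteq> 0" using z[OF x0C] by auto
  define H where "H = {x. z \<bullet> x < 1}"
  define S where "S = (\<Union>c\<in>C. \<Union>v\<in>A ` H. {c - v})"
  have "convex H" unfolding H_def by (rule convex_halfspace_lt)
  then have "convex S"
    unfolding S_def using lin conv by (intro convex_differences convex_linear_image)
  moreover have "A x0 - A 0 \<in> S"
    unfolding S_def using x0C by (force simp: H_def)
  moreover have "0 \<notin> S"
    using z by (force simp: S_def H_def)
  \<comment> \<open>\<open>S\<close> is the difference of \<open>C\<close> and the image of
    \<open>H\<close>, so separating it from \<open>0\<close> separates these two sets. Taking
    \<open>a\<close> in \<open>span S\<close> makes the separation proper: \<open>a\<close> cannot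
    vanish on all of \<open>S\<close>.\<close>
  ultimately obtain a where a: "a \<in> span S" "a \<noteq> 0" "\<And>s. s \<in> S \<Longrightarrow> 0 \<le> a \<bullet> s"
    using separating_hyperplane_set_0_inspan[of S] by blast
  have bd: "adjoint A a \<bullet> x \<le> a \<bullet> c" if "c \<in> C" "z \<bullet> x < 1" for c x
  proof -
    have "c - A x \<in> S" using that by (auto simp: S_def H_def)
    then show ?thesis
      using a(3) lin by (force simp: adjoint_clauses inner_diff_right)
  qed
  obtain l where l: "0 \<le> l" "adjoint A a = l *\<^sub>R z"
    using halfspace_functional_bounded[OF bd[OF x0C] z0] by blast
  \<comment> \<open>The multiplier obtained from each \<open>c\<close> is the same \<open>l\<close>,
    because \<open>z\<close> is nonzero.\<close>
  have l_le: "l \<le> a \<bullet> c" if c: "c \<in> C" for c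
  proof -
    obtain l' where "l' \<le> a \<bullet> c" "adjoint A a = l' *\<^sub>R z"
      using halfspace_functional_bounded[OF bd[OF c] z0] by blast
    then show ?thesis using l z0 by simp
  qed
  \<comment> \<open>If \<open>l = 0\<close>, then \<open>a\<close> vanishes on the range of
    \<open>A\<close> and attains its minimum over \<open>C\<close> at \<open>A x0\<close>. Hence it
    vanishes on \<open>C\<close> and on \<open>S\<close>, which makes it orthogonal to
    itself.\<close>
  have "l \<noteq> 0"
  proof
    assume "l = 0"
    then have perp: "a \<bullet> A x = 0" for x
      using l(2) lin by (metis adjoint_clauses(2) inner_zero_left scaleR_zero_left)
    have "a \<bullet> c = 0" if "c \<in> C" for c
      using rel_interior_minimum_imp_constant[OF conv x0 _ that] l_le \<open>l = 0\<close> perp by simp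
    then have "orthogonal a s" if "s \<in> S" for s
      using that perp by (auto simp: S_def orthogonal_def inner_diff_right)
    then have "orthogonal a a" using a(1) orthogonal_to_span by blast
    then show False using a(2) by (simp add: orthogonal_self)
  qed
  with l have "l > 0" by simp
  have "(1 / l) *\<^sub>R a \<in> antipolar C"
    using l_le \<open>l > 0\<close> by (auto simp: antipolar_def)
  moreover have "adjoint A ((1 / l) *\<^sub>R a) = z"
    using l \<open>l \<noteq> 0\<close> lin by (simp add: linear_scale adjoint_linear)
  ultimately show "z \<in> adjoint A ` antipolar C" by (metis imageI)
qed

section \<open>The polyhedral case, by a Farkas argument\<close>

lemma polyhedron_halfspaces:
  fixes C :: "'a::euclidean_space set"
  assumes "polyhedron C"
  obtains F :: "('a \<times> real) set"
    where "finite F" "C = {x. \<forall>(a, b)\<in>F. a \<bullet> x \<le> b}"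
proof -
  obtain G where G: "finite G" "C = \<Inter>G"
    and half: "\<forall>h\<in>G. \<exists>a b. a \<noteq> 0 \<and> h = {x. a \<bullet> x \<le> b}"
    using assms unfolding polyhedron_def by (elim exE conjE) (rule that)
  obtain a b where ab: "\<forall>h\<in>G. a h \<noteq> 0 \<and> h = {x. a h \<bullet> x \<le> b h}"
    using half unfolding bchoice_iff by (elim exE) (rule that)
  have "x \<in> h \<longleftrightarrow> a h \<bullet> x \<le> b h" if "h \<in> G" for x h
    using arg_cong[OF conjunct2[OF bspec[OF ab that]], of "\<lambda>s. x \<in> s"]
    by (simp only: mem_Collect_eq)
  then have "C = {x. \<forall>(a, b)\<in>(\<lambda>h. (a h, b h)) ` G. a \<bullet> x \<le> b}"
    by (auto simp: G(2))
  then show thesis by (intro that[of "(\<lambda>h. (a h, b h)) ` G"] finite_imageI G(1))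
qed

text \<open>Strict separation gives some threshold \<open>b\<close>, negative since \<open>0\<close>
  lies in \<open>K\<close>. A negative value of \<open>u\<close> on \<open>K\<close> could be scaled
  below \<open>b\<close>, so the threshold can be raised to \<open>0\<close>.\<close>

lemma convex_cone_separate:
  fixes K :: "'a::euclidean_space set"
  assumes "convex_cone K" "closed K" "k \<notin> K"
  obtains u where "u \<bullet> k < 0" "\<And>v. v \<in> K \<Longrightarrow> 0 \<le> u \<bullet> v"
proof -
  obtain u b where u: "u \<bullet> k < b" "\<And>v. v \<in> K \<Longrightarrow> b < u \<bullet> v"
    using separating_hyperplane_closed_point[of K k] assms by (auto simp: convex_cone_def)
  have "b < 0" using u(2)[OF convex_cone_contains_0[OF assms(1)]] by simp
  moreover have "0 \<le> u \<bullet> v" if v: "v \<in> K" for v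
  proof -
    have "- (u \<bullet> v) \<le> 0"
    proof (rule bounded_above_on_ray_imp_nonpos)
      fix t :: real
      assume "t > 0"
      then have "t *\<^sub>R v \<in> K" using v assms(1) by (simp add: convex_cone_scaleR)
      then show "0 + t * - (u \<bullet> v) \<le> - b" using u(2) by force
    qed
    then show ?thesis by simp
  qed
  ultimately show thesis using u(1) that by force
qed

lemma antipolar_vimage_subset_polyhedron:
  fixes A :: "'x::euclidean_space \<Rightarrow> 'y::euclidean_space"
  assumes lin: "linear A" and poly: "polyhedron C" and ne: "A -` C \<noteq> {}"
  shows "antipolar (A -` C) \<subseteq> adjoint A ` antipolar C"
proof
  fix z assume "z \<in> antipolar (A -` C)"
  then have z: "z \<bullet> x \<ge> 1" if "A x \<in> C" for x
    using that by (auto simp: antipolar_def)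
  obtain x0 where x0: "A x0 \<in> C" using ne by blast
  obtain F where F: "finite F" and C: "C = {x. \<forall>(a, b)\<in>F. a \<bullet> x \<le> b}"
    using polyhedron_halfspaces[OF poly] .
  \<comment> \<open>The pair \<open>(0, 1)\<close> is the trivial inequality
    \<open>0 \<le> 1\<close>. It allows right-hand sides to be weakened and, dually, forces
    \<open>t \<ge> 0\<close> below.\<close>
  define G where "G = insert (0, 1) F"
  define L where "L = (\<lambda>(v, s::real). (adjoint A v, s))"
  have linL: "linear L"
    using adjoint_linear[OF lin]
    by (auto simp: L_def linear_iff)
  define K where "K = L ` (convex_cone hull G)"
  have K_hull: "K = convex_cone hull (L ` G)"
    unfolding K_def using convex_cone_hull_linear_image[OF linL] by simp
  have cK: "convex_cone K" "closed K"
    unfolding K_hull using F by (auto simp: G_def convex_cone_convex_cone_hull closed_convex_cone_hull)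
  have gen: "L g \<in> K" if "g \<in> G" for g
    unfolding K_hull using that by (simp add: hull_inc)
  have "(- z, - 1) \<in> K"
  proof (rule ccontr)
    assume "(- z, - 1) \<notin> K"
    then obtain w where w: "w \<bullet> (- z, - 1) < 0" "\<And>v. v \<in> K \<Longrightarrow> 0 \<le> w \<bullet> v"
      using convex_cone_separate[OF cK] by blast
    obtain u t where ut: "w = (u, t)" by (cases w)
    have zu: "u \<bullet> z + t > 0" using w(1) by (simp add: ut)
    have t: "t \<ge> 0" using w(2)[OF gen, of "(0, 1)"] adjoint_linear[OF lin]
      by (simp add: ut G_def L_def linear_0)
    have F': "a \<bullet> A u + t * b \<ge> 0" if "(a, b) \<in> F" for a b
    proof -
      have "0 \<le> u \<bullet> adjoint A a + t * b"
        using w(2)[OF gen, of "(a, b)"] that by (simp add: ut G_def L_def)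
      then show ?thesis using lin by (simp add: adjoint_clauses inner_commute)
    qed
    show False
    \<comment> \<open>For \<open>t = 0\<close>, the ray from \<open>x0\<close> in direction
      \<open>- u\<close> stays in the preimage of \<open>C\<close>, so \<open>z\<close> cannot
      decrease along it without bound. For \<open>t > 0\<close>, the point
      \<open>- (1 / t) *\<^sub>R u\<close> lies in the preimage but has inner product less than
      \<open>1\<close> with \<open>z\<close>.\<close>
    proof (cases "t = 0")
      case True
      have "u \<bullet> z \<le> 0"
      proof (rule bounded_above_on_ray_imp_nonpos)
        fix s :: real
        assume s: "s > 0"
        have "A (x0 - s *\<^sub>R u) \<in> C"
          unfolding C
        proof clarify
          fix a b assume ab: "(a, b) \<in> F"
          have "a \<bullet> A x0 \<le> b" using x0 ab by (auto simp: C)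
          moreover have "0 \<le> s * (a \<bullet> A u)" using F'[OF ab] True s by simp
          ultimately show "a \<bullet> A (x0 - s *\<^sub>R u) \<le> b"
            using lin by (simp add: linear_diff linear_scale inner_diff_right)
        qed
        then show "0 + s * (u \<bullet> z) \<le> z \<bullet> x0 - 1"
          using z by (force simp: inner_diff_right inner_commute)
      qed
      then show False using zu True by simp
    next
      case False
      with t have t: "t > 0" by simp
      have "A (- (1 / t) *\<^sub>R u) \<in> C"
        unfolding C
      proof clarify
        fix a b assume "(a, b) \<in> F"
        then show "a \<bullet> A (- (1 / t) *\<^sub>R u) \<le> b"
          using F' lin t by (fastforce simp: linear_neg linear_scale field_simps)
      qed
      from z[OF this] show False using zu t by (simp add: field_simps inner_commute)
    qed
  qed
  then obtain v where v: "(v, - 1) \<in> convex_cone hull G" "adjoint A v = - z"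
    by (auto simp: K_def L_def)
  have "v \<bullet> c \<le> - 1" if c: "c \<in> C" for c
  proof -
    \<comment> \<open>For fixed \<open>c\<close> in \<open>C\<close>, being satisfied at
      \<open>c\<close> is a homogeneous linear condition on a pair \<open>(a, b)\<close>, so it
      passes from the generators to the whole cone.\<close>
    have "convex_cone hull G \<subseteq> {p. (c, - 1) \<bullet> p \<le> 0}"
      using c by (intro hull_minimal convex_cone_halfspace_le)
        (auto simp: G_def C inner_commute)
    then show ?thesis using v(1) by (auto simp: inner_commute)
  qed
  then have "- v \<in> antipolar C" by (force simp: antipolar_def)
  moreover have "adjoint A (- v) = z"
    using v(2) adjoint_linear[OF lin] by (simp add: linear_neg)
  ultimately show "z \<in> adjoint A ` antipolar C" by (metis imageI)
qed

theorem proposition3p5: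
  fixes A :: "'x::euclidean_space \<Rightarrow> 'y::euclidean_space"
    and C :: "'y set"
  assumes "linear A"
    and "C \<noteq> {}" and "closed C" and "convex C" and "0 \<notin> C"
    and "A -` C \<noteq> {}"
    and "polyhedron C \<or> rel_interior C \<inter> range A \<noteq> {}"
  shows "antipolar (A -` C) \<noteq> {} \<and> antipolar (A -` C) = adjoint A ` antipolar C"
proof
  show "antipolar (A -` C) \<noteq> {}"
  proof (rule antipolar_nonempty)
    show "convex (A -` C)" using \<open>linear A\<close> \<open>convex C\<close> by (rule convex_linear_vimage)
    show "closed (A -` C)" using \<open>linear A\<close> \<open>closed C\<close>
      by (simp add: continuous_closed_vimage linear_continuous_at linear_conv_bounded_linear)
    show "0 \<notin> A -` C" using \<open>linear A\<close> \<open>0 \<notin> C\<close> by (simp add: linear_0)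
  qed
  have "antipolar (A -` C) \<subseteq> adjoint A ` antipolar C"
    using assms(7)
  proof
    assume "polyhedron C"
    with \<open>linear A\<close> show ?thesis
      using \<open>A -` C \<noteq> {}\<close> by (rule antipolar_vimage_subset_polyhedron)
  next
    assume "rel_interior C \<inter> range A \<noteq> {}"
    with \<open>linear A\<close> \<open>convex C\<close> show ?thesis
      by (rule antipolar_vimage_subset_rel_interior)
  qed
  then show "antipolar (A -` C) = adjoint A ` antipolar C"
    using adjoint_antipolar_subset[OF \<open>linear A\<close>] by (rule equalityI)
qed

end
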